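(* An LTLf specification is realizable iff it admits a bounded winning strategy, i.e. a strategy for which there exists $B > 0$ such that every induced finite trace has length at most $B$. There exist realizable constrained LTLf specifications that do not possess any bounded winning strategy.
   Context: Let $\mathcal{X}$ (uncontrollable) and $\mathcal{Y}$ (controllable) be disjoint finite sets of propositional variables. An LTLf specification $\langle \mathcal{X}, \mathcal{Y}, \varphi \rangle$ has $\varphi$ an LTL formula interpreted over finite traces. A strategy for it is a function $\sigma: (2^{\mathcal{X}})^* \rightarrow 2^{\mathcal{Y} \cup \{\mathsf{end}\}}$ such that for every infinite sequence $\mathbf{X}=X_1X_2\ldots$ of subsets of $\mathcal{X}$ there is exactly one $n\geq1$ with $\mathsf{end}\in\sigma(X_1\cdots X_n)$; the induced finite trace is $(X_1\cup\sigma(X_1))\cdots(X_n\cup\sigma(X_1\cdots X_n))$ with $\mathsf{end}$ removed, and $\sigma$ is winning if all induced finite traces satisfy $\varphi$. A constrained LTLf specification $\langle \mathcal{X}, \mathcal{Y}, \alpha, \varphi \rangle$ adds an LTL assumption $\alpha$ interpreted over infinite traces; strategies output $\mathsf{end}$ at most once per $\mathbf{X}$; a strategy is an $\alpha$-strategy if for every $\mathbf{X}$ either $\mathsf{end}$ is output at some finite step or the induced infinite trace $(X_1\cup\sigma(X_1))(X_2\cup\sigma(X_1X_2))\cdots$ violates $\alpha$; it is winning if it is an $\alpha$-strategy and every induced finite trace satisfies $\varphi$. Realizability means a winning strategy exists. *)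

theory Defs
  imports Main "HOL-Library.FuncSet"
begin

text \<open>The usual complete set of LTL connectives; disjunction, weak next, release, eventually and
  always are definable from it over both finite and infinite traces.\<close>

datatype (ltl_vars: 'v) ltl =
    LTrue
  | LProp 'v
  | LNot "'v ltl"
  | LAnd "'v ltl" "'v ltl"
  | LNext "'v ltl"
  | LUntil "'v ltl" "'v ltl"

fun ltl_sat_at :: "(nat \<Rightarrow> 'v set) \<Rightarrow> nat \<Rightarrow> 'v ltl \<Rightarrow> bool" where
  "ltl_sat_at w i LTrue \<longleftrightarrow> True"
| "ltl_sat_at w i (LProp p) \<longleftrightarrow> p \<in> w i"
| "ltl_sat_at w i (LNot f) \<longleftrightarrow> \<not> ltl_sat_at w i f"
| "ltl_sat_at w i (LAnd f g) \<longleftrightarrow> ltl_sat_at w i f \<and> ltl_sat_at w i g"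
| "ltl_sat_at w i (LNext f) \<longleftrightarrow> ltl_sat_at w (Suc i) f"
| "ltl_sat_at w i (LUntil f g) \<longleftrightarrow>
     (\<exists>j\<ge>i. ltl_sat_at w j g \<and> (\<forall>k. i \<le> k \<and> k < j \<longrightarrow> ltl_sat_at w k f))"

definition ltl_sat :: "(nat \<Rightarrow> 'v set) \<Rightarrow> 'v ltl \<Rightarrow> bool" where
  "ltl_sat w f \<longleftrightarrow> ltl_sat_at w 0 f"

text \<open>Finite traces are nonempty lists, evaluated at positions below the length; next is strong.\<close>

fun ltlf_sat_at :: "'v set list \<Rightarrow> nat \<Rightarrow> 'v ltl \<Rightarrow> bool" where
  "ltlf_sat_at w i LTrue \<longleftrightarrow> True"
| "ltlf_sat_at w i (LProp p) \<longleftrightarrow> p \<in> w ! i"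
| "ltlf_sat_at w i (LNot f) \<longleftrightarrow> \<not> ltlf_sat_at w i f"
| "ltlf_sat_at w i (LAnd f g) \<longleftrightarrow> ltlf_sat_at w i f \<and> ltlf_sat_at w i g"
| "ltlf_sat_at w i (LNext f) \<longleftrightarrow> Suc i < length w \<and> ltlf_sat_at w (Suc i) f"
| "ltlf_sat_at w i (LUntil f g) \<longleftrightarrow>
     (\<exists>j. i \<le> j \<and> j < length w \<and> ltlf_sat_at w j g \<and>
          (\<forall>k. i \<le> k \<and> k < j \<longrightarrow> ltlf_sat_at w k f))"

definition ltlf_sat :: "'v set list \<Rightarrow> 'v ltl \<Rightarrow> bool" where
  "ltlf_sat w f \<longleftrightarrow> ltlf_sat_at w 0 f"

definition ltlf_spec :: "'v set \<Rightarrow> 'v set \<Rightarrow> 'v ltl \<Rightarrow> bool" where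
  "ltlf_spec X Y \<phi> \<longleftrightarrow> finite X \<and> finite Y \<and> X \<inter> Y = {} \<and> ltl_vars \<phi> \<subseteq> X \<union> Y"

definition constrained_spec :: "'v set \<Rightarrow> 'v set \<Rightarrow> 'v ltl \<Rightarrow> 'v ltl \<Rightarrow> bool" where
  "constrained_spec X Y \<alpha> \<phi> \<longleftrightarrow> ltlf_spec X Y \<phi> \<and> ltl_vars \<alpha> \<subseteq> X \<union> Y"

text \<open>Strategy outputs are sets of tagged symbols, so that \<open>End\<close> is fresh by construction.\<close>

datatype 'v out = Out 'v | End

type_synonym 'v strategy = "'v set list \<Rightarrow> 'v out set"

definition strategy_functions :: "'v set \<Rightarrow> 'v set \<Rightarrow> 'v strategy set" where
  "strategy_functions X Y = lists (Pow X) \<rightarrow> Pow (Out ` Y \<union> {End})"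

definition env_sequences :: "'v set \<Rightarrow> (nat \<Rightarrow> 'v set) set" where
  "env_sequences X = {\<xi>. \<forall>i. \<xi> i \<subseteq> X}"

text \<open>Input sequences are indexed from 0: \<open>\<xi> i\<close> is the input of step \<open>i + 1\<close>.\<close>

definition prefix :: "(nat \<Rightarrow> 'v set) \<Rightarrow> nat \<Rightarrow> 'v set list" where
  "prefix \<xi> n = map \<xi> [0..<n]"

definition ends_at :: "'v strategy \<Rightarrow> (nat \<Rightarrow> 'v set) \<Rightarrow> nat \<Rightarrow> bool" where
  "ends_at \<sigma> \<xi> n \<longleftrightarrow> 1 \<le> n \<and> End \<in> \<sigma> (prefix \<xi> n)"

definition infinite_trace :: "'v strategy \<Rightarrow> (nat \<Rightarrow> 'v set) \<Rightarrow> nat \<Rightarrow> 'v set" where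
  "infinite_trace \<sigma> \<xi> i = \<xi> i \<union> {v. Out v \<in> \<sigma> (prefix \<xi> (Suc i))}"

definition induced_finite_traces :: "'v set \<Rightarrow> 'v strategy \<Rightarrow> 'v set list set" where
  "induced_finite_traces X \<sigma> =
     {map (infinite_trace \<sigma> \<xi>) [0..<n] | \<xi> n. \<xi> \<in> env_sequences X \<and> ends_at \<sigma> \<xi> n}"

definition bounded_strategy :: "'v set \<Rightarrow> 'v strategy \<Rightarrow> bool" where
  "bounded_strategy X \<sigma> \<longleftrightarrow> (\<exists>B>0. \<forall>w \<in> induced_finite_traces X \<sigma>. length w \<le> B)"

definition ltlf_strategy :: "'v set \<Rightarrow> 'v set \<Rightarrow> 'v strategy \<Rightarrow> bool" where
  "ltlf_strategy X Y \<sigma> \<longleftrightarrow>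
     \<sigma> \<in> strategy_functions X Y \<and> (\<forall>\<xi> \<in> env_sequences X. \<exists>!n. ends_at \<sigma> \<xi> n)"

definition ltlf_winning :: "'v set \<Rightarrow> 'v set \<Rightarrow> 'v ltl \<Rightarrow> 'v strategy \<Rightarrow> bool" where
  "ltlf_winning X Y \<phi> \<sigma> \<longleftrightarrow>
     ltlf_strategy X Y \<sigma> \<and> (\<forall>w \<in> induced_finite_traces X \<sigma>. ltlf_sat w \<phi>)"

definition ltlf_realizable :: "'v set \<Rightarrow> 'v set \<Rightarrow> 'v ltl \<Rightarrow> bool" where
  "ltlf_realizable X Y \<phi> \<longleftrightarrow> (\<exists>\<sigma>. ltlf_winning X Y \<phi> \<sigma>)"

definition constrained_strategy :: "'v set \<Rightarrow> 'v set \<Rightarrow> 'v strategy \<Rightarrow> bool" where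
  "constrained_strategy X Y \<sigma> \<longleftrightarrow>
     \<sigma> \<in> strategy_functions X Y \<and>
     (\<forall>\<xi> \<in> env_sequences X. \<forall>m n. ends_at \<sigma> \<xi> m \<and> ends_at \<sigma> \<xi> n \<longrightarrow> m = n)"

definition alpha_strategy :: "'v set \<Rightarrow> 'v set \<Rightarrow> 'v ltl \<Rightarrow> 'v strategy \<Rightarrow> bool" where
  "alpha_strategy X Y \<alpha> \<sigma> \<longleftrightarrow>
     constrained_strategy X Y \<sigma> \<and>
     (\<forall>\<xi> \<in> env_sequences X. (\<exists>n. ends_at \<sigma> \<xi> n) \<or> \<not> ltl_sat (infinite_trace \<sigma> \<xi>) \<alpha>)"

definition constrained_winning ::
    "'v set \<Rightarrow> 'v set \<Rightarrow> 'v ltl \<Rightarrow> 'v ltl \<Rightarrow> 'v strategy \<Rightarrow> bool" where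
  "constrained_winning X Y \<alpha> \<phi> \<sigma> \<longleftrightarrow>
     alpha_strategy X Y \<alpha> \<sigma> \<and> (\<forall>w \<in> induced_finite_traces X \<sigma>. ltlf_sat w \<phi>)"

definition constrained_realizable ::
    "'v set \<Rightarrow> 'v set \<Rightarrow> 'v ltl \<Rightarrow> 'v ltl \<Rightarrow> bool" where
  "constrained_realizable X Y \<alpha> \<phi> \<longleftrightarrow> (\<exists>\<sigma>. constrained_winning X Y \<alpha> \<phi> \<sigma>)"

end

theory Submission imports Defs begin

text \<open>
  Inputs range over the finite alphabet of subsets of \<open>X\<close>, so the tree of input words is finitely
  branching, and by compactness a strategy that stops on every branch stops within a
  uniform number of steps: every winning strategy of an LTLf specification is bounded.
  Under an assumption the environment may postpone its obligation arbitrarily. With one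
  uncontrollable variable \<open>p\<close> and assumption and goal both ``eventually \<open>p\<close>'', stopping at the
  first \<open>p\<close> is winning, but every winning strategy has to wait for \<open>p\<close>, which comes after any bound.
\<close>

text \<open>Koenig's lemma in contrapositive form: by \<open>step\<close>, a word failing
  \<open>P\<close> has a one-letter extension failing \<open>P\<close>, and choosing such a letter
  again and again from the empty word yields the branch. In the application, finiteness of the
  alphabet enters when \<open>step\<close> is verified.\<close>

lemma branch_avoiding:
  assumes root: "\<not> P []"
    and step: "\<And>u. (\<forall>x\<in>A. P (u @ [x])) \<Longrightarrow> P u"
  shows "\<exists>\<xi>. \<forall>n. \<xi> n \<in> A \<and> \<not> P (map \<xi> [0..<n])"
proof -
  define next_letter where "next_letter u = (SOME x. x \<in> A \<and> \<not> P (u @ [x]))" for u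
  define word where "word = rec_nat [] (\<lambda>_ u. u @ [next_letter u])"
  define \<xi> where "\<xi> n = next_letter (word n)" for n
  have next_letter: "next_letter u \<in> A \<and> \<not> P (u @ [next_letter u])" if "\<not> P u" for u
    unfolding next_letter_def by (rule someI_ex) (use step that in blast)
  have word_avoids: "\<not> P (word n)" for n
    by (induction n) (simp_all add: word_def root next_letter)
  have "word n = map \<xi> [0..<n]" for n
    by (induction n) (simp_all add: word_def \<xi>_def)
  then have "\<forall>n. \<xi> n \<in> A \<and> \<not> P (map \<xi> [0..<n])"
    using word_avoids next_letter by (metis \<xi>_def)
  then show ?thesis by blast
qed

lemma length_prefix [simp]: "length (prefix \<xi> n) = n"
  by (simp add: prefix_def)

lemma prefix_Suc: "prefix \<xi> (Suc n) = prefix \<xi> n @ [\<xi> n]"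
  by (simp add: prefix_def)

lemma ltlf_strategy_bounded:
  assumes "finite X" and strat: "ltlf_strategy X Y \<sigma>"
  shows "bounded_strategy X \<sigma>"
proof -
  \<comment> \<open>The property pushed down the tree is the existence of a uniform bound on the
    stopping steps of all plays through \<open>u\<close>; the goal is the case
    \<open>u = []\<close>.\<close>
  define stops_within where "stops_within u B \<longleftrightarrow>
    (\<forall>\<xi>\<in>env_sequences X. \<forall>n. prefix \<xi> (length u) = u \<and> ends_at \<sigma> \<xi> n \<longrightarrow> n \<le> B)" for u B
  have step: "\<exists>B. stops_within u B" if bounds: "\<forall>x\<in>Pow X. \<exists>B. stops_within (u @ [x]) B" for u
  proof -
    obtain b where b: "\<forall>x\<in>Pow X. stops_within (u @ [x]) (b x)"
      using bchoice[OF bounds] by blast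
    \<comment> \<open>Every play through \<open>u\<close> continues with one of finitely many
      letters, so the largest of the bounds chosen for the successors works for
      \<open>u\<close>.\<close>
    have "n \<le> Max (b ` Pow X)"
      if "\<xi> \<in> env_sequences X" "prefix \<xi> (length u) = u" "ends_at \<sigma> \<xi> n" for \<xi> n
    proof -
      have mem: "\<xi> (length u) \<in> Pow X"
        using that(1) by (simp add: env_sequences_def)
      have "n \<le> b (\<xi> (length u))"
        using b mem that by (fastforce simp: stops_within_def prefix_Suc)
      also have "\<dots> \<le> Max (b ` Pow X)"
        using mem \<open>finite X\<close> by (intro Max_ge) auto
      finally show ?thesis .
    qed
    then show ?thesis
      unfolding stops_within_def by blast
  qed
  have "\<exists>B. stops_within [] B"
  proof (rule ccontr)
    assume "\<not> (\<exists>B. stops_within [] B)"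
    from branch_avoiding[of "\<lambda>u. \<exists>B. stops_within u B" "Pow X", OF this step]
    obtain \<xi> where \<xi>: "\<forall>n. \<xi> n \<in> Pow X" "\<forall>n B. \<not> stops_within (prefix \<xi> n) B"
      unfolding prefix_def by blast
    have "\<xi> \<in> env_sequences X"
      using \<xi>(1) by (simp add: env_sequences_def)
    then obtain n where n: "ends_at \<sigma> \<xi> n"
      using strat unfolding ltlf_strategy_def by blast
    \<comment> \<open>A play sharing its first \<open>n\<close> inputs with \<open>\<xi>\<close>
      also outputs \<open>End\<close> at step \<open>n\<close>, since the output depends on those
      inputs alone; uniqueness of the stopping step excludes any other.\<close>
    have "stops_within (prefix \<xi> n) n"
      unfolding stops_within_def
    proof (intro ballI allI impI)
      fix \<zeta> m
      assume \<zeta>: "\<zeta> \<in> env_sequences X"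
        and "prefix \<zeta> (length (prefix \<xi> n)) = prefix \<xi> n \<and> ends_at \<sigma> \<zeta> m"
      then have "ends_at \<sigma> \<zeta> n" "ends_at \<sigma> \<zeta> m"
        using n by (auto simp: ends_at_def)
      then show "m \<le> n"
        using strat \<zeta> unfolding ltlf_strategy_def by blast
    qed
    then show False
      using \<xi>(2) by blast
  qed
  then obtain B where "stops_within [] B" ..
  \<comment> \<open>\<open>Suc B\<close> rather than \<open>B\<close>, because the bound has to be
    positive.\<close>
  then have "\<forall>w\<in>induced_finite_traces X \<sigma>. length w \<le> Suc B"
    by (fastforce simp: stops_within_def induced_finite_traces_def prefix_def)
  then show ?thesis
    unfolding bounded_strategy_def by blast
qed

definition eventually_prop :: "'v \<Rightarrow> 'v ltl" where
  "eventually_prop p = LUntil LTrue (LProp p)"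

lemma ltl_sat_eventually_prop: "ltl_sat w (eventually_prop p) \<longleftrightarrow> (\<exists>i. p \<in> w i)"
  by (simp add: ltl_sat_def eventually_prop_def)

lemma ltlf_sat_eventually_prop:
  "ltlf_sat w (eventually_prop p) \<longleftrightarrow> (\<exists>i<length w. p \<in> w ! i)"
  by (simp add: ltlf_sat_def eventually_prop_def)

lemma constrained_spec_eventually_prop:
  "constrained_spec {p} {} (eventually_prop p) (eventually_prop p)"
  by (simp add: constrained_spec_def ltlf_spec_def eventually_prop_def)

text \<open>Looking back through \<open>butlast u\<close> keeps \<open>End\<close> from being output
  again at later occurrences of \<open>p\<close>. The test \<open>u \<noteq> []\<close> guards
  \<open>last\<close>, which is unspecified on the empty list.\<close>

definition stop_at_first :: "'v \<Rightarrow> 'v strategy" where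
  "stop_at_first p u =
     (if u \<noteq> [] \<and> p \<in> last u \<and> (\<forall>x\<in>set (butlast u). p \<notin> x) then {End} else {})"

lemma ends_at_stop_at_first:
  "ends_at (stop_at_first p) \<xi> n \<longleftrightarrow> (\<exists>m. n = Suc m \<and> p \<in> \<xi> m \<and> (\<forall>i<m. p \<notin> \<xi> i))"
  by (cases n) (auto simp: ends_at_def stop_at_first_def prefix_def)

lemma infinite_trace_stop_at_first: "infinite_trace (stop_at_first p) \<xi> = \<xi>"
  by (rule ext) (simp add: infinite_trace_def stop_at_first_def)

lemma stop_at_first_winning:
  "constrained_winning {p} {} (eventually_prop p) (eventually_prop p) (stop_at_first p)"
proof -
  have "constrained_strategy {p} {} (stop_at_first p)"
    unfolding constrained_strategy_def strategy_functions_def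
    by (auto simp: stop_at_first_def ends_at_stop_at_first intro: linorder_cases)
  moreover have "\<exists>n. ends_at (stop_at_first p) \<xi> n" if "p \<in> \<xi> i" for \<xi> i
    using exists_least_iff[of "\<lambda>i. p \<in> \<xi> i"] that unfolding ends_at_stop_at_first by blast
  ultimately have "alpha_strategy {p} {} (eventually_prop p) (stop_at_first p)"
    unfolding alpha_strategy_def ltl_sat_eventually_prop infinite_trace_stop_at_first by blast
  moreover have "ltlf_sat w (eventually_prop p)"
    if "w \<in> induced_finite_traces {p} (stop_at_first p)" for w
    using that
    by (auto simp: induced_finite_traces_def ltlf_sat_eventually_prop ends_at_stop_at_first
        infinite_trace_stop_at_first nth_append)
  ultimately show ?thesis
    unfolding constrained_winning_def by blast
qed

lemma eventually_prop_not_bounded: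
  assumes win: "constrained_winning {p} {} (eventually_prop p) (eventually_prop p) \<sigma>"
  shows "\<not> bounded_strategy {p} \<sigma>"
proof
  assume "bounded_strategy {p} \<sigma>"
  then obtain B where B: "\<forall>w\<in>induced_finite_traces {p} \<sigma>. length w \<le> B"
    unfolding bounded_strategy_def by blast
  \<comment> \<open>With indices from 0, \<open>p\<close> arrives at step \<open>B + 1\<close>, just
    too late for a trace of length at most \<open>B\<close>.\<close>
  define \<xi> :: "nat \<Rightarrow> 'a set" where "\<xi> i = (if i = B then {p} else {})" for i
  have env: "\<xi> \<in> env_sequences {p}"
    by (simp add: env_sequences_def \<xi>_def)
  have "\<sigma> \<in> strategy_functions {p} {}"
    using win by (simp add: constrained_winning_def alpha_strategy_def constrained_strategy_def)
  moreover have "prefix \<xi> n \<in> lists (Pow {p})" for n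
    using env by (fastforce simp: prefix_def env_sequences_def)
  \<comment> \<open>There are no controllable variables, so the strategy cannot add \<open>p\<close>
    to the trace itself.\<close>
  ultimately have "\<sigma> (prefix \<xi> n) \<subseteq> {End}" for n
    unfolding strategy_functions_def by fastforce
  then have trace: "infinite_trace \<sigma> \<xi> = \<xi>"
    by (fastforce simp: infinite_trace_def fun_eq_iff)
  have "ltl_sat (infinite_trace \<sigma> \<xi>) (eventually_prop p)"
    unfolding trace ltl_sat_eventually_prop by (auto simp: \<xi>_def)
  \<comment> \<open>The assumption holds on this play, so never stopping is no way out.\<close>
  then obtain n where n: "ends_at \<sigma> \<xi> n"
    using win env unfolding constrained_winning_def alpha_strategy_def by blast
  then have ind: "map \<xi> [0..<n] \<in> induced_finite_traces {p} \<sigma>"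
    unfolding induced_finite_traces_def using env trace by force
  then have "n \<le> B"
    using B by fastforce
  moreover have "ltlf_sat (map \<xi> [0..<n]) (eventually_prop p)"
    using win ind unfolding constrained_winning_def by blast
  ultimately show False
    by (auto simp: ltlf_sat_eventually_prop \<xi>_def split: if_splits)
qed

theorem theorem3:
  "(\<forall>X Y (\<phi> :: 'v ltl). ltlf_spec X Y \<phi> \<longrightarrow>
      (ltlf_realizable X Y \<phi> \<longleftrightarrow> (\<exists>\<sigma>. ltlf_winning X Y \<phi> \<sigma> \<and> bounded_strategy X \<sigma>))) \<and>
   (\<exists>X Y (\<alpha> :: 'v ltl) (\<phi> :: 'v ltl). constrained_spec X Y \<alpha> \<phi> \<and>
      constrained_realizable X Y \<alpha> \<phi> \<and>
      \<not> (\<exists>\<sigma>. constrained_winning X Y \<alpha> \<phi> \<sigma> \<and> bounded_strategy X \<sigma>))"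
proof (intro conjI allI impI)
  fix X Y :: "'v set" and \<phi> :: "'v ltl"
  assume "ltlf_spec X Y \<phi>"
  then have "finite X"
    by (simp add: ltlf_spec_def)
  then show "ltlf_realizable X Y \<phi> \<longleftrightarrow> (\<exists>\<sigma>. ltlf_winning X Y \<phi> \<sigma> \<and> bounded_strategy X \<sigma>)"
    unfolding ltlf_realizable_def ltlf_winning_def using ltlf_strategy_bounded by blast
next
  \<comment> \<open>Types are inhabited, so some \<open>p\<close> is available for the
    counterexample over any \<open>'v\<close>.\<close>
  fix p :: 'v
  show "\<exists>X Y (\<alpha> :: 'v ltl) (\<phi> :: 'v ltl). constrained_spec X Y \<alpha> \<phi> \<and>
      constrained_realizable X Y \<alpha> \<phi> \<and>
      \<not> (\<exists>\<sigma>. constrained_winning X Y \<alpha> \<phi> \<sigma> \<and> bounded_strategy X \<sigma>)"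
    unfolding constrained_realizable_def
    using constrained_spec_eventually_prop[of p] stop_at_first_winning[of p]
      eventually_prop_not_bounded[of p] by blast
qed

end
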